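(* Let $(M,\nu,\mathfrak{e})$, $(\mathscr{O},\eta,e)$, $\tau$ form a $c$-monop. Let $(m_1,a_1),(m_2,a_2),(m_3,a_3)$ be nested elements: $(m_1,a_1)\in M[V_1]\times E(\mathscr{O})[V_2]\subseteq (M\cdot E(\mathscr{O}))[V]$ with $V=V_1+V_2$; $(m_2,a_2)\in M[\pi_1]\times E(\mathscr{O})[\pi_2]$ where $\pi=\pi_1+\pi_2$ is a splitting of the partition $\pi$ underlying $a_1$; $(m_3,a_3)\in M[\varsigma_1]\times E(\mathscr{O})[\varsigma_2]$ where $\varsigma=\varsigma_1+\varsigma_2$ is a splitting of the partition $\varsigma$ underlying $a_2$. Then: (1) (associativity) $\bar\rho(\bar\rho((m_1,a_1),(m_2,a_2)),(m_3,a_3))=\bar\rho((m_1,a_1),\bar\rho((m_2,a_2),(m_3,a_3)))$; (2) (left cancellation) if $\bar\rho((m_1,a_1),(m_2,a_2))=\bar\rho((m_1,a_1),(m_2',a_2'))$ then $(m_2,a_2)=(m_2',a_2')$; (3) (no proper divisors of the identity) if $\bar\rho((m_1,a_1),(m_2,a_2))=(\mathfrak{e},\{e_v\}_{v\in V})$, then $m_1=m_2=\mathfrak{e}$ and $a_1=a_2$ are the assemblies of identity singletons.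
   Context: Species are functors from finite sets with bijections to finite sets; positive means $F[\emptyset]=\emptyset$; sums are disjoint unions. Product $(M\cdot N)[V]=\sum_{V_1+V_2=V}M[V_1]\times N[V_2]$. For positive $P$, $R(P)[V]=\sum_\pi(\prod_{B\in\pi}P[B])\times R[\pi]$ over partitions $\pi$ of $V$; elements are pairs $(a,r)$ with $a=\{p_B\}_{B\in\pi}$ an assembly of $P$-structures. $E(P)[V]$ is the set of all assemblies of $P$-structures on $V$ (only the empty assembly if $V=\emptyset$). Monoid $(M,\nu,\mathfrak e)$: $\nu:M\cdot M\to M$ associative with two-sided unit $\mathfrak e\in M[\emptyset]$. Operad $(\mathscr O,\eta,e)$: $\mathscr O$ positive, $\eta:\mathscr O(\mathscr O)\to\mathscr O$, $e_v\in\mathscr O[\{v\}]$; for an assembly $a=\{\omega_C\}_{C\in\pi}$ on $V$ and an assembly $b=\{w_D\}_{D\in\sigma}$ on the set $\pi$, $\bar\eta(a,b)=\{\eta(\{\omega_C\}_{C\in D},w_D)\}_{D\in\sigma}$ (assembly on $V$ with partition identified with $\sigma$); axioms $\eta(\bar\eta(a,b),\omega)=\eta(a,\eta(b,\omega))$, $\eta(\{e_v\}_{v\in V},\omega)=\omega=\eta(\{\omega\},e_V)$. Right module: $\tau:M(\mathscr O)\to M$ with $\tau(\bar\eta(a,b),m)=\tau(a,\tau(b,m))$ and $\tau(\{e_v\}_{v\in V},m)=m$. Compatibility: $\nu(\tau(a_1,m_1),\tau(a_2,m_2))=\tau(a_1\sqcup a_2,\nu(m_1,m_2))$ for disjoint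 supports. A $c$-monop is such data ($M$ a monoid and right $\mathscr O$-module with $\nu,\tau$ compatible, so that $(M,\mathscr O)$ is a monop with $\rho=\nu\circ(M\cdot\tau)$) with in addition: $|M[\emptyset]|=1$; $\nu(m_1,m_2)=\nu(m_1,m_2')\Rightarrow m_2=m_2'$; $|\mathscr O[\{v\}]|=1$ for every singleton; $\eta(a,\omega)=\eta(a,\omega')\Rightarrow\omega=\omega'$; and $\tau(a,m)=\tau(a,m')\Rightarrow m=m'$. Product $\bar\rho$: for $(m_1,a_1)\in M[V_1]\times E(\mathscr O)[V_2]$ with $a_1$ having underlying partition $\pi$, and $(m_2',a_2')\in M[\pi_1]\times E(\mathscr O)[\pi_2]$ for a splitting $\pi=\pi_1+\pi_2$ (either part may be empty), let $a_1^{(i)}$ be the subassembly of $a_1$ with underlying partition $\pi_i$, and set $\bar\rho((m_1,a_1),(m_2',a_2'))=(\nu(m_1,\tau(a_1^{(1)},m_2')),\bar\eta(a_1^{(2)},a_2'))$. *)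

theory Defs
  imports Main "HOL-Library.FSet" "HOL-Library.Disjoint_Sets"
begin

text \<open>
  Operads need a species to be evaluated on a finite set, on a partition of it, on a partition of
  that partition, and so on. The points of all these sets are therefore taken from one type,
  closed under the formation of finite sets: finite sets built up hereditarily over arbitrary
  atoms. The underlying sets of species are the finite subsets of this type.
\<close>

datatype 'a hset = Atom 'a | Node "'a hset fset"

primrec elts :: "'a hset \<Rightarrow> 'a hset set" where
  "elts (Atom x) = {}"
| "elts (Node X) = fset X"

text \<open>A finite set regarded as a point; only meaningful for finite arguments.\<close>

definition blk :: "'a hset set \<Rightarrow> 'a hset" where
  "blk B = Node (Abs_fset B)"

definition hUnion :: "'a hset set \<Rightarrow> 'a hset set" where
  "hUnion \<pi> = (\<Union>B\<in>\<pi>. elts B)"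

definition is_partition :: "'a hset set \<Rightarrow> 'a hset set \<Rightarrow> bool" where
  "is_partition V \<pi> \<longleftrightarrow> (\<exists>P. partition_on V P \<and> \<pi> = blk ` P)"


section \<open>Species\<close>

text \<open>
  \<open>mor F V f\<close> is the transport along the bijection \<open>f : V \<rightarrow> f ` V\<close>; the codomain is determined
  by \<open>V\<close> and \<open>f\<close>, and only the values of \<open>f\<close> on \<open>V\<close> matter.
\<close>

record ('a, 's) species_data =
  obj :: "'a hset set \<Rightarrow> 's set"
  mor :: "'a hset set \<Rightarrow> ('a hset \<Rightarrow> 'a hset) \<Rightarrow> 's \<Rightarrow> 's"

locale species =
  fixes F :: "('a, 's) species_data"
  assumes finite_obj: "finite V \<Longrightarrow> finite (obj F V)"
    and mor_in: "finite V \<Longrightarrow> bij_betw f V W \<Longrightarrow> s \<in> obj F V \<Longrightarrow> mor F V f s \<in> obj F W"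
    and mor_cong: "finite V \<Longrightarrow> bij_betw f V W \<Longrightarrow> (\<And>v. v \<in> V \<Longrightarrow> f v = g v) \<Longrightarrow>
      s \<in> obj F V \<Longrightarrow> mor F V f s = mor F V g s"
    and mor_id: "finite V \<Longrightarrow> s \<in> obj F V \<Longrightarrow> mor F V id s = s"
    and mor_comp: "finite V \<Longrightarrow> bij_betw f V W \<Longrightarrow> bij_betw g W U \<Longrightarrow> s \<in> obj F V \<Longrightarrow>
      mor F V (g \<circ> f) s = mor F W g (mor F V f s)"

locale species_hom =
  fixes F :: "('a, 's) species_data" and G :: "('a, 't) species_data"
    and \<phi> :: "'a hset set \<Rightarrow> 's \<Rightarrow> 't"
  assumes hom_in: "finite V \<Longrightarrow> s \<in> obj F V \<Longrightarrow> \<phi> V s \<in> obj G V"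
    and hom_natural: "finite V \<Longrightarrow> bij_betw f V W \<Longrightarrow> s \<in> obj F V \<Longrightarrow>
      mor G V f (\<phi> V s) = \<phi> W (mor F V f s)"

text \<open>
  Structures carry their underlying sets as tags, so that the union over all splittings
  is a disjoint one.
\<close>

definition sprod :: "('a, 'm) species_data \<Rightarrow> ('a, 'n) species_data \<Rightarrow>
    ('a, ('a hset set \<times> 'm) \<times> ('a hset set \<times> 'n)) species_data" where
  "sprod M N =
    \<lparr> obj = (\<lambda>V. {((V1, m), (V2, n)) | V1 m V2 n.
        V1 \<union> V2 = V \<and> V1 \<inter> V2 = {} \<and> m \<in> obj M V1 \<and> n \<in> obj N V2}),
      mor = (\<lambda>V f ((V1, m), (V2, n)). ((f ` V1, mor M V1 f m), (f ` V2, mor N V2 f n))) \<rparr>"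

text \<open>
  An assembly \<open>{p\<^sub>B}\<close>, indexed by the blocks \<open>B\<close> of a partition, is the set of all pairs
  \<open>(B, p\<^sub>B)\<close>. Its underlying partition is \<open>Domain a\<close>. The species \<open>asm P\<close> is \<open>E(P)\<close>.
\<close>

definition asm :: "('a, 'p) species_data \<Rightarrow> ('a, ('a hset \<times> 'p) set) species_data" where
  "asm P =
    \<lparr> obj = (\<lambda>V. {a. single_valued a \<and> is_partition V (Domain a) \<and>
        (\<forall>(B, p)\<in>a. p \<in> obj P (elts B))}),
      mor = (\<lambda>V f a. (\<lambda>(B, p). (blk (f ` elts B), mor P (elts B) f p)) ` a) \<rparr>"

definition subasm :: "('a hset \<times> 'p) set \<Rightarrow> 'a hset set \<Rightarrow> ('a hset \<times> 'p) set" where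
  "subasm a \<pi> = {(B, p) \<in> a. B \<in> \<pi>}"

definition scompose :: "('a, 'r) species_data \<Rightarrow> ('a, 'p) species_data \<Rightarrow>
    ('a, ('a hset \<times> 'p) set \<times> 'r) species_data" where
  "scompose R P =
    \<lparr> obj = (\<lambda>V. {(a, r). a \<in> obj (asm P) V \<and> r \<in> obj R (Domain a)}),
      mor = (\<lambda>V f (a, r). (mor (asm P) V f a, mor R (Domain a) (\<lambda>B. blk (f ` elts B)) r)) \<rparr>"


section \<open>Monoids, operads and modules\<close>

locale species_monoid =
  species M + species_hom "sprod M M" M \<nu>
  for M :: "('a, 'm) species_data"
    and \<nu> :: "'a hset set \<Rightarrow> ('a hset set \<times> 'm) \<times> ('a hset set \<times> 'm) \<Rightarrow> 'm"
    and \<ee> :: 'm +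
  assumes unit_in: "\<ee> \<in> obj M {}"
    and assoc: "finite V1 \<Longrightarrow> finite V2 \<Longrightarrow> finite V3 \<Longrightarrow>
      V1 \<inter> V2 = {} \<Longrightarrow> V1 \<inter> V3 = {} \<Longrightarrow> V2 \<inter> V3 = {} \<Longrightarrow>
      m1 \<in> obj M V1 \<Longrightarrow> m2 \<in> obj M V2 \<Longrightarrow> m3 \<in> obj M V3 \<Longrightarrow>
      \<nu> (V1 \<union> V2 \<union> V3) ((V1 \<union> V2, \<nu> (V1 \<union> V2) ((V1, m1), (V2, m2))), (V3, m3)) =
      \<nu> (V1 \<union> V2 \<union> V3) ((V1, m1), (V2 \<union> V3, \<nu> (V2 \<union> V3) ((V2, m2), (V3, m3))))"
    and unit_left: "finite V \<Longrightarrow> m \<in> obj M V \<Longrightarrow> \<nu> V (({}, \<ee>), (V, m)) = m"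
    and unit_right: "finite V \<Longrightarrow> m \<in> obj M V \<Longrightarrow> \<nu> V ((V, m), ({}, \<ee>)) = m"

definition idasm :: "('a hset \<Rightarrow> 'o) \<Rightarrow> 'a hset set \<Rightarrow> ('a hset \<times> 'o) set" where
  "idasm e V = (\<lambda>v. (blk {v}, e v)) ` V"

text \<open>
  If \<open>b\<close> is an assembly on the partition \<open>Domain a\<close>, then \<open>etabar \<eta> a b\<close> is an assembly whose
  underlying partition is \<open>flat ` Domain b\<close>: the map \<open>flat\<close> is the bijection along which this
  partition is identified with \<open>Domain b\<close>.
\<close>

definition flat :: "'a hset \<Rightarrow> 'a hset" where
  "flat D = blk (hUnion (elts D))"

definition etabar ::
  "('a hset set \<Rightarrow> ('a hset \<times> 'o) set \<times> 'o \<Rightarrow> 'o) \<Rightarrow>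
    ('a hset \<times> 'o) set \<Rightarrow> ('a hset \<times> 'o) set \<Rightarrow> ('a hset \<times> 'o) set" where
  "etabar \<eta> a b = (\<lambda>(D, w). (flat D, \<eta> (hUnion (elts D)) (subasm a (elts D), w))) ` b"

locale operad =
  species Op + species_hom "scompose Op Op" Op \<eta>
  for Op :: "('a, 'o) species_data"
    and \<eta> :: "'a hset set \<Rightarrow> ('a hset \<times> 'o) set \<times> 'o \<Rightarrow> 'o"
    and e :: "'a hset \<Rightarrow> 'o" +
  assumes positive: "obj Op {} = {}"
    and e_in: "e v \<in> obj Op {v}"
    and e_natural: "mor Op {v} f (e v) = e (f v)"
    and eta_assoc: "finite V \<Longrightarrow> a \<in> obj (asm Op) V \<Longrightarrow> b \<in> obj (asm Op) (Domain a) \<Longrightarrow>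
      \<omega> \<in> obj Op (Domain b) \<Longrightarrow>
      \<eta> V (etabar \<eta> a b, mor Op (Domain b) flat \<omega>) = \<eta> V (a, \<eta> (Domain a) (b, \<omega>))"
    and eta_unit_left: "finite V \<Longrightarrow> \<omega> \<in> obj Op V \<Longrightarrow>
      \<eta> V (idasm e V, mor Op V (\<lambda>v. blk {v}) \<omega>) = \<omega>"
    and eta_unit_right: "finite V \<Longrightarrow> \<omega> \<in> obj Op V \<Longrightarrow> \<eta> V ({(blk V, \<omega>)}, e (blk V)) = \<omega>"

locale right_module =
  operad Op \<eta> e + carrier: species M + action: species_hom "scompose M Op" M \<tau>
  for M :: "('a, 'm) species_data"
    and Op :: "('a, 'o) species_data"
    and \<eta> :: "'a hset set \<Rightarrow> ('a hset \<times> 'o) set \<times> 'o \<Rightarrow> 'o"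
    and e :: "'a hset \<Rightarrow> 'o"
    and \<tau> :: "'a hset set \<Rightarrow> ('a hset \<times> 'o) set \<times> 'm \<Rightarrow> 'm" +
  assumes tau_assoc: "finite V \<Longrightarrow> a \<in> obj (asm Op) V \<Longrightarrow> b \<in> obj (asm Op) (Domain a) \<Longrightarrow>
      m \<in> obj M (Domain b) \<Longrightarrow>
      \<tau> V (etabar \<eta> a b, mor M (Domain b) flat m) = \<tau> V (a, \<tau> (Domain a) (b, m))"
    and tau_unit: "finite V \<Longrightarrow> m \<in> obj M V \<Longrightarrow>
      \<tau> V (idasm e V, mor M V (\<lambda>v. blk {v}) m) = m"

locale c_monop =
  monoid: species_monoid M \<nu> \<ee> + module: right_module M Op \<eta> e \<tau>
  for M :: "('a, 'm) species_data"
    and \<nu> :: "'a hset set \<Rightarrow> ('a hset set \<times> 'm) \<times> ('a hset set \<times> 'm) \<Rightarrow> 'm"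
    and \<ee> :: 'm
    and Op :: "('a, 'o) species_data"
    and \<eta> :: "'a hset set \<Rightarrow> ('a hset \<times> 'o) set \<times> 'o \<Rightarrow> 'o"
    and e :: "'a hset \<Rightarrow> 'o"
    and \<tau> :: "'a hset set \<Rightarrow> ('a hset \<times> 'o) set \<times> 'm \<Rightarrow> 'm" +
  assumes compatible: "finite V1 \<Longrightarrow> finite V2 \<Longrightarrow> V1 \<inter> V2 = {} \<Longrightarrow>
      a1 \<in> obj (asm Op) V1 \<Longrightarrow> a2 \<in> obj (asm Op) V2 \<Longrightarrow>
      m1 \<in> obj M (Domain a1) \<Longrightarrow> m2 \<in> obj M (Domain a2) \<Longrightarrow>
      \<nu> (V1 \<union> V2) ((V1, \<tau> V1 (a1, m1)), (V2, \<tau> V2 (a2, m2))) =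
      \<tau> (V1 \<union> V2) (a1 \<union> a2,
        \<nu> (Domain a1 \<union> Domain a2) ((Domain a1, m1), (Domain a2, m2)))"
    and card_M_empty: "card (obj M {}) = 1"
    and nu_cancel: "finite V1 \<Longrightarrow> finite V2 \<Longrightarrow> V1 \<inter> V2 = {} \<Longrightarrow>
      m1 \<in> obj M V1 \<Longrightarrow> m2 \<in> obj M V2 \<Longrightarrow> m2' \<in> obj M V2 \<Longrightarrow>
      \<nu> (V1 \<union> V2) ((V1, m1), (V2, m2)) = \<nu> (V1 \<union> V2) ((V1, m1), (V2, m2')) \<Longrightarrow> m2 = m2'"
    and card_Op_singleton: "card (obj Op {v}) = 1"
    and eta_cancel: "finite V \<Longrightarrow> a \<in> obj (asm Op) V \<Longrightarrow>
      \<omega> \<in> obj Op (Domain a) \<Longrightarrow> \<omega>' \<in> obj Op (Domain a) \<Longrightarrow>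
      \<eta> V (a, \<omega>) = \<eta> V (a, \<omega>') \<Longrightarrow> \<omega> = \<omega>'"
    and tau_cancel: "finite V \<Longrightarrow> a \<in> obj (asm Op) V \<Longrightarrow>
      m \<in> obj M (Domain a) \<Longrightarrow> m' \<in> obj M (Domain a) \<Longrightarrow>
      \<tau> V (a, m) = \<tau> V (a, m') \<Longrightarrow> m = m'"

definition rhobar ::
  "('a hset set \<Rightarrow> ('a hset set \<times> 'm) \<times> ('a hset set \<times> 'm) \<Rightarrow> 'm) \<Rightarrow>
   ('a hset set \<Rightarrow> ('a hset \<times> 'o) set \<times> 'o \<Rightarrow> 'o) \<Rightarrow>
   ('a hset set \<Rightarrow> ('a hset \<times> 'o) set \<times> 'm \<Rightarrow> 'm) \<Rightarrow>
   ('a hset set \<times> 'm) \<times> ('a hset set \<times> ('a hset \<times> 'o) set) \<Rightarrow>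
   ('a hset set \<times> 'm) \<times> ('a hset set \<times> ('a hset \<times> 'o) set) \<Rightarrow>
   ('a hset set \<times> 'm) \<times> ('a hset set \<times> ('a hset \<times> 'o) set)" where
  "rhobar \<nu> \<eta> \<tau> = (\<lambda>((V1, m1), (V2, a1)) ((\<pi>1, m2), (\<pi>2, a2)).
    ((V1 \<union> hUnion \<pi>1,
      \<nu> (V1 \<union> hUnion \<pi>1) ((V1, m1), (hUnion \<pi>1, \<tau> (hUnion \<pi>1) (subasm a1 \<pi>1, m2)))),
     (hUnion \<pi>2, etabar \<eta> (subasm a1 \<pi>2) a2)))"

end

theory Submission
  imports Defs
begin

text \<open>
  Everything rests on the observation that \<open>flat\<close> restricts injectively to iterated partitions and
  that restricting \<open>etabar \<eta> a b\<close> to the flattened blocks \<open>flat ` \<sigma>\<close> amounts to restricting \<open>b\<close>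
  to \<open>\<sigma>\<close> and \<open>a\<close> to the blocks under \<open>\<sigma>\<close>. Associativity then follows blockwise from the
  associativity of \<open>\<eta>\<close> on the operad side, and from compatibility, the associativity of \<open>\<tau>\<close> and
  that of \<open>\<nu>\<close> on the monoid side. For cancellation, a subset of a partition is determined by its
  union, so the underlying sets can be recovered and the cancellation laws of \<open>\<nu>\<close>, \<open>\<tau>\<close> and \<open>\<eta>\<close>
  apply. In a product equal to the identity all flattened blocks are singletons, hence so are the
  blocks of both factors, and the structures on singletons and on the empty set are unique.
\<close>

section \<open>Partitions\<close>

lemma finite_elts [simp]: "finite (elts x)"
  by (cases x) auto

lemma elts_blk [simp]: "finite B \<Longrightarrow> elts (blk B) = B"
  by (simp add: blk_def Abs_fset_inverse)

lemma hUnion_empty [simp]: "hUnion {} = {}"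
  by (simp add: hUnion_def)

lemma hUnion_Un: "hUnion (A \<union> B) = hUnion A \<union> hUnion B"
  by (auto simp: hUnion_def)

lemma hUnion_mono: "A \<subseteq> B \<Longrightarrow> hUnion A \<subseteq> hUnion B"
  by (auto simp: hUnion_def)

lemma finite_hUnion [simp]: "finite A \<Longrightarrow> finite (hUnion A)"
  by (simp add: hUnion_def)

text \<open>Trades the existential over set partitions for conditions on the points of
  \<open>\<pi>\<close>: \<open>blk (elts B) = B\<close> says that \<open>B\<close> codes a finite
  set and is not an atom. Finiteness of \<open>V\<close> makes all blocks finite, and there
  \<open>elts\<close> inverts \<open>blk\<close>.\<close>

lemma is_partition_iff:
  assumes "finite V"
  shows "is_partition V \<pi> \<longleftrightarrow> (\<forall>B\<in>\<pi>. blk (elts B) = B \<and> elts B \<noteq> {}) \<and>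
    (\<forall>B\<in>\<pi>. \<forall>C\<in>\<pi>. B \<noteq> C \<longrightarrow> elts B \<inter> elts C = {}) \<and> hUnion \<pi> = V" (is "?L \<longleftrightarrow> ?R")
proof
  assume ?L
  then obtain P where P: "partition_on V P" and \<pi>: "\<pi> = blk ` P"
    unfolding is_partition_def by blast
  then have "\<Union> P = V" "{} \<notin> P" "disjoint P"
    by (simp_all add: partition_on_def)
  have elts: "elts (blk B) = B" if "B \<in> P" for B
  proof -
    have "B \<subseteq> V"
      using that \<open>\<Union> P = V\<close> by blast
    then show ?thesis
      using assms by (simp add: finite_subset)
  qed
  have "hUnion \<pi> = V"
    using \<open>\<Union> P = V\<close> elts unfolding \<pi> hUnion_def by simp
  moreover have "elts (blk B) \<inter> elts (blk C) = {}" if "B \<in> P" "C \<in> P" "blk B \<noteq> blk C" for B C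
    using that \<open>disjoint P\<close> elts[of B] elts[of C] unfolding disjoint_def by metis
  moreover have "elts (blk B) \<noteq> {}" if "B \<in> P" for B
    using that \<open>{} \<notin> P\<close> elts[of B] by metis
  ultimately show ?R
    using elts unfolding \<pi> by simp
next
  assume R: ?R
  have "\<Union> (elts ` \<pi>) = V"
    using R by (simp add: hUnion_def)
  moreover have "{} \<notin> elts ` \<pi>"
    using R by blast
  moreover have "disjoint (elts ` \<pi>)"
    unfolding disjoint_def by (metis R imageE)
  ultimately have "partition_on V (elts ` \<pi>)"
    unfolding partition_on_def by blast
  moreover have "blk ` elts ` \<pi> = id ` \<pi>"
    unfolding image_image using R by (intro image_cong) simp_all
  then have "\<pi> = blk ` elts ` \<pi>"
    by simp
  ultimately show ?L
    unfolding is_partition_def by blast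
qed

lemma is_partition_hUnion: "finite V \<Longrightarrow> is_partition V \<pi> \<Longrightarrow> hUnion \<pi> = V"
  by (simp add: is_partition_iff)

lemma is_partition_disjoint:
  "finite V \<Longrightarrow> is_partition V \<pi> \<Longrightarrow> B \<in> \<pi> \<Longrightarrow> C \<in> \<pi> \<Longrightarrow> x \<in> elts B \<Longrightarrow> x \<in> elts C \<Longrightarrow> B = C"
  by (simp add: is_partition_iff disjoint_iff) metis

lemma is_partition_blk: "finite V \<Longrightarrow> is_partition V \<pi> \<Longrightarrow> B \<in> \<pi> \<Longrightarrow> blk (elts B) = B"
  by (simp add: is_partition_iff)

lemma is_partition_nonempty: "finite V \<Longrightarrow> is_partition V \<pi> \<Longrightarrow> B \<in> \<pi> \<Longrightarrow> elts B \<noteq> {}"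
  by (simp add: is_partition_iff)

lemma is_partition_subset:
  assumes "finite V" "is_partition V \<pi>" "\<pi>' \<subseteq> \<pi>"
  shows "is_partition (hUnion \<pi>') \<pi>'"
proof -
  have "finite (hUnion \<pi>')"
    using assms hUnion_mono is_partition_hUnion finite_subset by metis
  then show ?thesis
    using assms by (simp add: is_partition_iff subset_iff)
qed

text \<open>\<open>elts\<close> embeds the partition into the power set of \<open>V\<close>; it is
  injective on blocks because \<open>blk\<close> undoes it.\<close>

lemma finite_is_partition:
  assumes "finite V" "is_partition V \<pi>"
  shows "finite \<pi>"
proof -
  have "elts ` \<pi> \<subseteq> Pow V"
    using is_partition_hUnion[OF assms] by (auto simp: hUnion_def)
  then have "finite (elts ` \<pi>)"
    using assms(1) by (meson finite_Pow_iff finite_subset)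
  moreover have "inj_on elts \<pi>"
    by (metis inj_onI is_partition_blk assms)
  ultimately show ?thesis
    by (rule finite_imageD)
qed

lemma hUnion_Int_empty:
  assumes "finite V" "is_partition V \<pi>" "A \<subseteq> \<pi>" "B \<subseteq> \<pi>" "A \<inter> B = {}"
  shows "hUnion A \<inter> hUnion B = {}"
  using is_partition_disjoint[OF assms(1,2)] assms(3-5) unfolding hUnion_def by blast

text \<open>Blocks are nonempty and pairwise disjoint: a block in \<open>A\<close> has a point, and
  the block in \<open>B\<close> covering this point must be the same block.\<close>

lemma hUnion_subset_cancel:
  assumes "finite V" "is_partition V \<pi>" "A \<subseteq> \<pi>" "B \<subseteq> \<pi>" "hUnion A \<subseteq> hUnion B"
  shows "A \<subseteq> B"
proof
  fix D assume D: "D \<in> A"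
  then obtain x where x: "x \<in> elts D"
    using is_partition_nonempty[OF assms(1,2)] assms(3) by blast
  then obtain C where "C \<in> B" "x \<in> elts C"
    using D assms(5) unfolding hUnion_def by blast
  then show "D \<in> B"
    using is_partition_disjoint[OF assms(1,2)] x D assms(3,4) by blast
qed

lemma hUnion_cancel:
  assumes "finite V" "is_partition V \<pi>" "A \<subseteq> \<pi>" "B \<subseteq> \<pi>" "hUnion A = hUnion B"
  shows "A = B"
  using hUnion_subset_cancel[OF assms(1,2)] assms(3-5) by (metis subset_antisym subset_refl)

section \<open>Flattening a partition of a partition\<close>

lemma elts_flat [simp]: "elts (flat D) = hUnion (elts D)"
  by (simp add: flat_def)

lemma hUnion_flat: "hUnion (flat ` \<sigma>) = hUnion (hUnion \<sigma>)"
  by (auto simp: hUnion_def)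

lemma elts_subset_hUnion: "D \<in> \<sigma> \<Longrightarrow> elts D \<subseteq> hUnion \<sigma>"
  by (auto simp: hUnion_def)

context
  fixes V \<pi> \<sigma> :: "'a hset set"
  assumes V: "finite V" and \<pi>: "is_partition V \<pi>" and \<sigma>: "is_partition \<pi> \<sigma>"
begin

lemma flat_block_subset: "D \<in> \<sigma> \<Longrightarrow> elts D \<subseteq> \<pi>"
  using elts_subset_hUnion is_partition_hUnion[OF finite_is_partition[OF V \<pi>] \<sigma>] by blast

text \<open>\<open>flat D\<close> retains the union of the blocks in \<open>D\<close>; as a set of
  blocks of \<open>\<pi>\<close>, \<open>elts D\<close> can be recovered from that union.\<close>

lemma inj_on_flat: "inj_on flat \<sigma>"
proof (rule inj_onI)
  fix D D' assume D: "D \<in> \<sigma>" "D' \<in> \<sigma>" "flat D = flat D'"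
  then have "hUnion (elts D) = hUnion (elts D')"
    using elts_flat by metis
  then have "elts D = elts D'"
    using hUnion_cancel[OF V \<pi> flat_block_subset flat_block_subset] D by blast
  then show "D = D'"
    using D is_partition_blk[OF finite_is_partition[OF V \<pi>] \<sigma>] by metis
qed

end

section \<open>Assemblies\<close>

lemma asm_iff: "a \<in> obj (asm P) V \<longleftrightarrow>
    single_valued a \<and> is_partition V (Domain a) \<and> (\<forall>(B, p)\<in>a. p \<in> obj P (elts B))"
  by (simp add: asm_def)

lemma asmD:
  assumes "a \<in> obj (asm P) V"
  shows "is_partition V (Domain a)" "single_valued a" "\<And>B p. (B, p) \<in> a \<Longrightarrow> p \<in> obj P (elts B)"
  using assms by (auto simp: asm_iff)

lemma finite_Domain_asm: "finite V \<Longrightarrow> a \<in> obj (asm P) V \<Longrightarrow> finite (Domain a)"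
  using finite_is_partition asmD(1) by blast

lemma Domain_subasm: "\<pi> \<subseteq> Domain a \<Longrightarrow> Domain (subasm a \<pi>) = \<pi>"
  by (auto simp: subasm_def)

lemma subasm_Domain: "subasm a (Domain a) = a"
  by (auto simp: subasm_def)

lemma subasm_subasm: "\<pi>' \<subseteq> \<pi> \<Longrightarrow> subasm (subasm a \<pi>) \<pi>' = subasm a \<pi>'"
  by (auto simp: subasm_def)

lemma subasm_Un: "subasm a (\<pi> \<union> \<pi>') = subasm a \<pi> \<union> subasm a \<pi>'"
  by (auto simp: subasm_def)

lemma subasm_in:
  assumes "finite V" "a \<in> obj (asm P) V" "\<pi> \<subseteq> Domain a"
  shows "subasm a \<pi> \<in> obj (asm P) (hUnion \<pi>)"
  using is_partition_subset[OF assms(1) asmD(1)[OF assms(2)] assms(3)] assms(2)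
    Domain_subasm[OF assms(3)]
  unfolding asm_iff by (auto simp: subasm_def single_valued_def)

lemma Domain_etabar: "Domain (etabar \<eta> a b) = flat ` Domain b"
  by (force simp: etabar_def)

lemma sprod_iff: "((V1, m), (V2, n)) \<in> obj (sprod M N) V \<longleftrightarrow>
    V1 \<union> V2 = V \<and> V1 \<inter> V2 = {} \<and> m \<in> obj M V1 \<and> n \<in> obj N V2"
  by (auto simp: sprod_def)

lemma scompose_iff: "(a, r) \<in> obj (scompose R P) V \<longleftrightarrow> a \<in> obj (asm P) V \<and> r \<in> obj R (Domain a)"
  by (simp add: scompose_def)

section \<open>Restriction and associativity of \<open>etabar\<close>\<close>

lemma etabar_cong:
  "(\<And>D w. (D, w) \<in> b \<Longrightarrow> subasm a (elts D) = subasm a' (elts D)) \<Longrightarrow> etabar \<eta> a b = etabar \<eta> a' b"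
  unfolding etabar_def by (rule image_cong[OF refl]) auto

text \<open>The component at \<open>flat D\<close> involves \<open>a\<close> only on the blocks in
  \<open>elts D\<close>, and these lie in \<open>hUnion \<sigma>\<close> when \<open>D\<close> is in
  \<open>\<sigma>\<close>.\<close>

lemma subasm_etabar:
  assumes "finite V" "a \<in> obj (asm P) V" "b \<in> obj (asm Q) (Domain a)" "\<sigma> \<subseteq> Domain b"
  shows "subasm (etabar \<eta> a b) (flat ` \<sigma>) = etabar \<eta> (subasm a (hUnion \<sigma>)) (subasm b \<sigma>)"
proof -
  have inj: "inj_on flat (Domain b)"
    using inj_on_flat assms asmD(1) by blast
  have "subasm (subasm a (hUnion \<sigma>)) (elts D) = subasm a (elts D)" if "D \<in> \<sigma>" for D
    using that by (intro subasm_subasm elts_subset_hUnion)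
  then have "etabar \<eta> (subasm a (hUnion \<sigma>)) (subasm b \<sigma>) = etabar \<eta> a (subasm b \<sigma>)"
    by (intro etabar_cong) (simp add: subasm_def[of b])
  moreover have "subasm (etabar \<eta> a b) (flat ` \<sigma>) \<subseteq> etabar \<eta> a (subasm b \<sigma>)"
  proof
    fix x assume "x \<in> subasm (etabar \<eta> a b) (flat ` \<sigma>)"
    then obtain D w C where Dw: "(D, w) \<in> b" and C: "C \<in> \<sigma>" "flat C = flat D"
      and x: "x = (flat D, \<eta> (hUnion (elts D)) (subasm a (elts D), w))"
      by (auto simp: subasm_def[of _ "flat ` \<sigma>"] etabar_def)
    \<comment> \<open>The restriction only yields some \<open>C\<close> in \<open>\<sigma>\<close>
      with the same flattening; injectivity of \<open>flat\<close> on the blocks of \<open>b\<close>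
      gives \<open>C = D\<close>.\<close>
    then have "D \<in> \<sigma>"
      using inj_onD[OF inj C(2)] assms(4) by blast
    then have "(D, w) \<in> subasm b \<sigma>"
      using Dw by (simp add: subasm_def)
    then show "x \<in> etabar \<eta> a (subasm b \<sigma>)"
      unfolding x etabar_def by (rule rev_image_eqI) simp
  qed
  moreover have "etabar \<eta> a (subasm b \<sigma>) \<subseteq> subasm (etabar \<eta> a b) (flat ` \<sigma>)"
    by (auto simp: subasm_def[of _ "flat ` \<sigma>"] subasm_def[of b] etabar_def)
  ultimately show ?thesis
    by blast
qed

context operad
begin

context
  fixes V a b
  assumes V: "finite V" and a: "a \<in> obj (asm Op) V" and b: "b \<in> obj (asm Op) (Domain a)"
begin

lemma etabar_block:
  assumes "(D, w) \<in> b"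
  shows "elts D \<subseteq> Domain a" "subasm a (elts D) \<in> obj (asm Op) (hUnion (elts D))"
    "Domain (subasm a (elts D)) = elts D" "w \<in> obj Op (elts D)"
proof -
  show *: "elts D \<subseteq> Domain a"
    using flat_block_subset[OF V asmD(1)[OF a] asmD(1)[OF b]] assms by blast
  show "subasm a (elts D) \<in> obj (asm Op) (hUnion (elts D))"
    by (rule subasm_in[OF V a *])
  show "Domain (subasm a (elts D)) = elts D"
    by (rule Domain_subasm[OF *])
  show "w \<in> obj Op (elts D)"
    by (rule asmD(3)[OF b assms])
qed

text \<open>On each block \<open>D\<close> of \<open>c\<close> this is \<open>eta_assoc\<close> for
  the parts of \<open>a\<close> and \<open>b\<close> lying under \<open>D\<close>. On the left
  \<open>c\<close> is transported along \<open>flat\<close> because the blocks of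
  \<open>etabar \<eta> a b\<close> are the flattened blocks of \<open>b\<close>.\<close>

lemma etabar_assoc:
  assumes c: "c \<in> obj (asm Op) (Domain b)"
  shows "etabar \<eta> (etabar \<eta> a b) (mor (asm Op) (Domain b) flat c) = etabar \<eta> a (etabar \<eta> b c)"
proof -
  have "(flat (blk (flat ` elts D)), \<eta> (hUnion (flat ` elts D))
          (subasm (etabar \<eta> a b) (flat ` elts D), mor Op (elts D) flat w)) =
        (flat (flat D), \<eta> (hUnion (hUnion (elts D)))
          (subasm a (hUnion (elts D)), \<eta> (hUnion (elts D)) (subasm b (elts D), w)))"
    if Dw: "(D, w) \<in> c" for D w
  proof -
    have D: "elts D \<subseteq> Domain b"
      using flat_block_subset[OF finite_Domain_asm[OF V a] asmD(1)[OF b] asmD(1)[OF c]] Dw by blast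
    have UD: "hUnion (elts D) \<subseteq> Domain a"
      using hUnion_mono[OF D] is_partition_hUnion[OF finite_Domain_asm[OF V a] asmD(1)[OF b]] by blast
    have "\<eta> (hUnion (hUnion (elts D)))
        (etabar \<eta> (subasm a (hUnion (elts D))) (subasm b (elts D)), mor Op (elts D) flat w) =
      \<eta> (hUnion (hUnion (elts D)))
        (subasm a (hUnion (elts D)), \<eta> (hUnion (elts D)) (subasm b (elts D), w))"
      using eta_assoc[OF _ subasm_in[OF V a UD], of "subasm b (elts D)" w]
        subasm_in[OF finite_Domain_asm[OF V a] b D] asmD(3)[OF c Dw]
      by (simp add: Domain_subasm D UD)
    \<comment> \<open>Both sides code the set \<open>hUnion (hUnion (elts D))\<close>: the order in
      which the levels are flattened is immaterial.\<close>
    moreover have "flat (blk (flat ` elts D)) = flat (flat D)"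
      unfolding flat_def[of "blk _"] flat_def[of "flat D"] by (simp add: hUnion_flat)
    ultimately show ?thesis
      using subasm_etabar[OF V a b D] by (simp add: hUnion_flat)
  qed
  then show ?thesis
    \<comment> \<open>The inner \<open>etabar \<eta> a b\<close> stays folded while both sides
      become images of \<open>c\<close>, to be compared pair by pair.\<close>
    unfolding etabar_def[of _ "etabar \<eta> a b"] etabar_def[of _ a "etabar \<eta> b c"]
    unfolding etabar_def[of _ b c] asm_def species_data.simps image_image
    by (intro image_cong[OF refl]) auto
qed

end

end

section \<open>The product\<close>

context c_monop
begin

lemma tau_in:
  "finite V \<Longrightarrow> a \<in> obj (asm Op) V \<Longrightarrow> m \<in> obj M (Domain a) \<Longrightarrow> \<tau> V (a, m) \<in> obj M V"
  by (simp add: module.action.hom_in scompose_iff)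

section \<open>Uniqueness of trivial structures, cancellation in \<open>etabar\<close>\<close>

lemma obj_M_empty: "m \<in> obj M {} \<Longrightarrow> m = \<ee>"
  using card_M_empty monoid.unit_in by (metis card_1_singletonE singletonD)

lemma obj_Op_singleton: "w \<in> obj Op {v} \<Longrightarrow> w = e v"
  using card_Op_singleton module.e_in by (metis card_1_singletonE singletonD)

text \<open>The component contributed by a pair \<open>(D, w)\<close> of \<open>b\<close> must also
  come from some \<open>(D', w')\<close> of \<open>b'\<close>. The flattened block forces
  \<open>D = D'\<close>, and \<open>eta_cancel\<close> on the part of \<open>a\<close> under
  \<open>D\<close> gives \<open>w = w'\<close>. One inclusion suffices by symmetry.\<close>

lemma etabar_cancel_subset:
  assumes V: "finite V" and a: "a \<in> obj (asm Op) V"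
    and b: "b \<in> obj (asm Op) (Domain a)" and b': "b' \<in> obj (asm Op) (Domain a)"
    and eq: "etabar \<eta> a b = etabar \<eta> a b'"
  shows "b \<subseteq> b'"
proof
  fix x assume "x \<in> b"
  then obtain D w where x: "x = (D, w)" and Dw: "(D, w) \<in> b"
    by (cases x) auto
  have "(flat D, \<eta> (hUnion (elts D)) (subasm a (elts D), w)) \<in> etabar \<eta> a b'"
    using Dw unfolding eq[symmetric] by (force simp: etabar_def)
  then obtain D' w' where Dw': "(D', w') \<in> b'" and flat: "flat D = flat D'"
    and eta: "\<eta> (hUnion (elts D)) (subasm a (elts D), w) =
      \<eta> (hUnion (elts D')) (subasm a (elts D'), w')"
    unfolding etabar_def by auto
  note B = module.etabar_block[OF V a b Dw] and B' = module.etabar_block[OF V a b' Dw']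
  \<comment> \<open>\<open>D\<close> and \<open>D'\<close> belong to possibly different partitions,
    so injectivity of \<open>flat\<close> on a single one does not apply; instead both are sets of
    blocks of \<open>a\<close> with the same union.\<close>
  have "elts D = elts D'"
    using hUnion_cancel[OF V asmD(1)[OF a] B(1) B'(1)] flat elts_flat by metis
  moreover from this have "D = D'"
    using is_partition_blk[OF finite_Domain_asm[OF V a]] asmD(1)[OF b] asmD(1)[OF b'] Dw Dw'
    by (metis DomainI)
  ultimately have "w = w'"
    using eta_cancel[OF _ B(2)] B(3,4) B'(4) eta by simp
  then show "x \<in> b'"
    using \<open>D = D'\<close> Dw' x by simp
qed

lemma etabar_cancel:
  "finite V \<Longrightarrow> a \<in> obj (asm Op) V \<Longrightarrow> b \<in> obj (asm Op) (Domain a) \<Longrightarrow>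
    b' \<in> obj (asm Op) (Domain a) \<Longrightarrow> etabar \<eta> a b = etabar \<eta> a b' \<Longrightarrow> b = b'"
  using etabar_cancel_subset[of V a b b'] etabar_cancel_subset[of V a b' b] by simp

text \<open>Each \<open>Op {v}\<close> has exactly one element, so singleton blocks leave no choice
  of structure.\<close>

lemma asm_singletons_eq_idasm:
  assumes V: "finite V" and a: "a \<in> obj (asm Op) V"
    and sing: "\<And>B. B \<in> Domain a \<Longrightarrow> \<exists>v. elts B = {v}"
  shows "a = idasm e V"
proof -
  have block: "B = blk {v} \<and> w = e v" if "(B, w) \<in> a" "v \<in> elts B" for B w v
  proof -
    have "elts B = {v}"
      using sing[OF DomainI[OF that(1)]] that(2) by auto
    then show ?thesis
      using is_partition_blk[OF V asmD(1)[OF a], of B] asmD(3)[OF a that(1)] that(1) obj_Op_singleton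
      by auto
  qed
  have U: "hUnion (Domain a) = V"
    by (rule is_partition_hUnion[OF V asmD(1)[OF a]])
  show ?thesis
  proof
    show "a \<subseteq> idasm e V"
    proof clarify
      fix B w assume Bw: "(B, w) \<in> a"
      then obtain v where v: "elts B = {v}"
        using sing by blast
      then have "v \<in> V"
        using Bw U by (force simp: hUnion_def)
      then show "(B, w) \<in> idasm e V"
        using block[OF Bw, of v] v by (simp add: idasm_def)
    qed
    show "idasm e V \<subseteq> a"
    proof
      fix x assume "x \<in> idasm e V"
      then obtain v where "v \<in> V" and x: "x = (blk {v}, e v)"
        by (auto simp: idasm_def)
      then obtain B w where "(B, w) \<in> a" "v \<in> elts B"
        using U by (auto simp: hUnion_def)
      then show "x \<in> a"
        using block x by blast
    qed
  qed
qed

lemma etabar_eq_idasm: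
  assumes V: "finite V" and a: "a \<in> obj (asm Op) V" and b: "b \<in> obj (asm Op) (Domain a)"
    and eq: "etabar \<eta> a b = idasm e V"
  shows "a = idasm e V" "b = idasm e (Domain a)"
proof -
  note fa = finite_Domain_asm[OF V a]
  have flat: "\<exists>v. hUnion (elts D) = {v}" if "D \<in> Domain b" for D
  proof -
    have "flat D \<in> Domain (idasm e V)"
      using that unfolding eq[symmetric] Domain_etabar by blast
    then obtain v where "flat D = blk {v}"
      by (auto simp: idasm_def)
    then show ?thesis
      by (metis elts_flat elts_blk finite.emptyI finite.insertI)
  qed
  have Ub: "hUnion (Domain b) = Domain a"
    by (rule is_partition_hUnion[OF fa asmD(1)[OF b]])
  \<comment> \<open>A nonempty subset of a one-point set is the whole set.\<close>
  have block: "elts B = hUnion (elts D)" if D: "D \<in> Domain b" and B: "B \<in> elts D" for B D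
  proof -
    have "elts B \<noteq> {}"
      using Ub D B is_partition_nonempty[OF V asmD(1)[OF a], of B] unfolding hUnion_def by blast
    moreover have "elts B \<subseteq> hUnion (elts D)"
      using B by (rule elts_subset_hUnion)
    ultimately show ?thesis
      using flat[OF D] by (metis subset_singletonD)
  qed
  show "a = idasm e V"
  proof (rule asm_singletons_eq_idasm[OF V a])
    fix B assume "B \<in> Domain a"
    then obtain D where "D \<in> Domain b" "B \<in> elts D"
      using Ub unfolding hUnion_def by blast
    then show "\<exists>v. elts B = {v}"
      using block flat by metis
  qed
  show "b = idasm e (Domain a)"
  proof (rule asm_singletons_eq_idasm[OF fa b])
    fix D assume D: "D \<in> Domain b"
    then have sub: "elts D \<subseteq> Domain a"
      using Ub elts_subset_hUnion by blast
    obtain B where B: "B \<in> elts D"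
      using is_partition_nonempty[OF fa asmD(1)[OF b] D] by blast
    \<comment> \<open>Every block in \<open>D\<close> has \<open>hUnion (elts D)\<close> as its set
      of elements, and a block is determined by its elements.\<close>
    have "C = B" if "C \<in> elts D" for C
      using block[OF D that] block[OF D B] is_partition_blk[OF V asmD(1)[OF a]] sub that B
      by (metis subsetD)
    then show "\<exists>v. elts D = {v}"
      using B by blast
  qed
qed

section \<open>The three properties of \<open>rhobar\<close>\<close>

context
  fixes V V1 V2 :: "'a hset set" and m1 a1 \<pi>1 \<pi>2 m2 a2
  assumes V: "finite V"
    and x1: "((V1, m1), (V2, a1)) \<in> obj (sprod M (asm Op)) V"
    and x2: "((\<pi>1, m2), (\<pi>2, a2)) \<in> obj (sprod M (asm Op)) (Domain a1)"
begin

lemma rhobar_operands: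
  shows "finite V1" "finite V2" "V1 \<inter> V2 = {}" "m1 \<in> obj M V1" "a1 \<in> obj (asm Op) V2"
    and "\<pi>1 \<union> \<pi>2 = Domain a1" "\<pi>1 \<inter> \<pi>2 = {}" "m2 \<in> obj M \<pi>1" "a2 \<in> obj (asm Op) \<pi>2"
    and "finite \<pi>1" "finite \<pi>2" "hUnion \<pi>1 \<inter> hUnion \<pi>2 = {}" "hUnion \<pi>1 \<union> hUnion \<pi>2 = V2"
proof -
  show V12: "finite V1" "finite V2" "V1 \<inter> V2 = {}" "m1 \<in> obj M V1"
    and a1: "a1 \<in> obj (asm Op) V2"
    using V x1 by (auto simp: sprod_iff)
  show \<pi>: "\<pi>1 \<union> \<pi>2 = Domain a1" "\<pi>1 \<inter> \<pi>2 = {}" "m2 \<in> obj M \<pi>1" "a2 \<in> obj (asm Op) \<pi>2"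
    using x2 by (auto simp: sprod_iff)
  show "finite \<pi>1" "finite \<pi>2"
    using finite_Domain_asm[OF V12(2) a1] \<pi>(1) by (metis finite_Un)+
  show "hUnion \<pi>1 \<inter> hUnion \<pi>2 = {}"
    using \<pi>(1,2) by (intro hUnion_Int_empty[OF V12(2) asmD(1)[OF a1]]) auto
  show "hUnion \<pi>1 \<union> hUnion \<pi>2 = V2"
    using is_partition_hUnion[OF V12(2) asmD(1)[OF a1]] \<pi>(1) by (metis hUnion_Un)
qed

lemma subasm_operand:
  assumes "\<rho> \<subseteq> Domain a1"
  shows "subasm a1 \<rho> \<in> obj (asm Op) (hUnion \<rho>)" "Domain (subasm a1 \<rho>) = \<rho>"
  using subasm_in[OF rhobar_operands(2,5) assms] Domain_subasm[OF assms] by auto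

text \<open>The third factor lives over \<open>Domain a2\<close>, whereas the assembly of the first
  product has the flattened blocks as its partition; hence the transport along \<open>flat\<close>
  on the left.\<close>

lemma rhobar_assoc:
  assumes x3: "((\<sigma>1, m3), (\<sigma>2, a3)) \<in> obj (sprod M (asm Op)) (Domain a2)"
  shows "rhobar \<nu> \<eta> \<tau> (rhobar \<nu> \<eta> \<tau> ((V1, m1), (V2, a1)) ((\<pi>1, m2), (\<pi>2, a2)))
      (mor (sprod M (asm Op)) (Domain a2) flat ((\<sigma>1, m3), (\<sigma>2, a3))) =
    rhobar \<nu> \<eta> \<tau> ((V1, m1), (V2, a1))
      (rhobar \<nu> \<eta> \<tau> ((\<pi>1, m2), (\<pi>2, a2)) ((\<sigma>1, m3), (\<sigma>2, a3)))"
proof -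
  note o = rhobar_operands
  have \<sigma>: "\<sigma>1 \<union> \<sigma>2 = Domain a2" "\<sigma>1 \<inter> \<sigma>2 = {}" "m3 \<in> obj M \<sigma>1" "a3 \<in> obj (asm Op) \<sigma>2"
    using x3 by (auto simp: sprod_iff)
  have \<sigma>1: "\<sigma>1 \<subseteq> Domain a2" and \<sigma>2: "\<sigma>2 \<subseteq> Domain a2"
    using \<sigma>(1) by auto
  have fin\<sigma>: "finite \<sigma>1" "finite \<sigma>2"
    using finite_Domain_asm[OF o(11,9)] \<sigma>1 \<sigma>2 finite_subset by blast+
  have U\<sigma>: "hUnion \<sigma>1 \<subseteq> \<pi>2" "hUnion \<sigma>2 \<subseteq> \<pi>2"
    using hUnion_mono[OF \<sigma>1] hUnion_mono[OF \<sigma>2] is_partition_hUnion[OF o(11) asmD(1)[OF o(9)]]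
    by auto
  have sub: "\<pi>1 \<subseteq> Domain a1" "\<pi>2 \<subseteq> Domain a1" "hUnion \<sigma>1 \<subseteq> Domain a1" "hUnion \<sigma>2 \<subseteq> Domain a1"
    using o(6) U\<sigma> by auto
  note s = subasm_operand[OF sub(1)] subasm_operand[OF sub(2)] subasm_operand[OF sub(3)]
    subasm_operand[OF sub(4)]
  have t: "subasm a2 \<sigma>1 \<in> obj (asm Op) (hUnion \<sigma>1)" "subasm a2 \<sigma>2 \<in> obj (asm Op) (hUnion \<sigma>2)"
    using subasm_in[OF o(11,9)] \<sigma>1 \<sigma>2 by auto
  have tD: "Domain (subasm a2 \<sigma>1) = \<sigma>1" "Domain (subasm a2 \<sigma>2) = \<sigma>2"
    using Domain_subasm \<sigma>1 \<sigma>2 by blast+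
  \<comment> \<open>Since \<open>hUnion \<sigma>\<close> lies in \<open>\<pi>2\<close>, the earlier
    restriction of \<open>a1\<close> to \<open>\<pi>2\<close> is absorbed.\<close>
  have restrict: "subasm (etabar \<eta> (subasm a1 \<pi>2) a2) (flat ` \<sigma>) =
      etabar \<eta> (subasm a1 (hUnion \<sigma>)) (subasm a2 \<sigma>)" if "\<sigma> \<subseteq> Domain a2" "hUnion \<sigma> \<subseteq> \<pi>2" for \<sigma>
    using subasm_etabar[of "hUnion \<pi>2" "subasm a1 \<pi>2" Op a2 Op \<sigma>] s o(9,11) that
    by (simp add: subasm_subasm)
  \<comment> \<open>\<open>p\<close> is \<open>m2\<close> acted on by \<open>a1\<close>, and
    \<open>r\<close> is \<open>m3\<close> acted on first by \<open>a2\<close> (giving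
    \<open>q\<close>) and then by \<open>a1\<close>. Both bracketings reduce to the product of
    \<open>m1\<close>, \<open>p\<close> and \<open>r\<close> in \<open>M\<close>.\<close>
  define p where "p = \<tau> (hUnion \<pi>1) (subasm a1 \<pi>1, m2)"
  define q where "q = \<tau> (hUnion \<sigma>1) (subasm a2 \<sigma>1, m3)"
  define r where "r = \<tau> (hUnion (hUnion \<sigma>1)) (subasm a1 (hUnion \<sigma>1), q)"
  have p: "p \<in> obj M (hUnion \<pi>1)" and q: "q \<in> obj M (hUnion \<sigma>1)"
    unfolding p_def q_def using o s t tD \<sigma> fin\<sigma> by (auto intro!: tau_in)
  have r: "r \<in> obj M (hUnion (hUnion \<sigma>1))"
    unfolding r_def using q s fin\<sigma> by (auto intro!: tau_in)
  \<comment> \<open>Left bracketing: the composed assembly acts on the transported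
    \<open>m3\<close>, and \<open>tau_assoc\<close> splits this into two successive actions.\<close>
  have "\<tau> (hUnion (hUnion \<sigma>1)) (subasm (etabar \<eta> (subasm a1 \<pi>2) a2) (flat ` \<sigma>1), mor M \<sigma>1 flat m3) = r"
    unfolding r_def q_def restrict[OF \<sigma>1 U\<sigma>(1)]
    using module.tau_assoc[of "hUnion (hUnion \<sigma>1)" "subasm a1 (hUnion \<sigma>1)" "subasm a2 \<sigma>1" m3]
      s t tD \<sigma> fin\<sigma> by simp
  moreover have disj: "hUnion \<pi>1 \<inter> hUnion (hUnion \<sigma>1) = {}" "V1 \<inter> hUnion \<pi>1 = {}"
    "V1 \<inter> hUnion (hUnion \<sigma>1) = {}"
    using o(3,12,13) hUnion_mono[OF U\<sigma>(1)] by blast+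
  \<comment> \<open>Right bracketing: \<open>a1\<close> acts on the product of \<open>m2\<close> and
    \<open>q\<close>, and compatibility distributes the action over the factors.\<close>
  moreover have "\<tau> (hUnion (\<pi>1 \<union> hUnion \<sigma>1)) (subasm a1 (\<pi>1 \<union> hUnion \<sigma>1),
      \<nu> (\<pi>1 \<union> hUnion \<sigma>1) ((\<pi>1, m2), (hUnion \<sigma>1, q))) =
      \<nu> (hUnion \<pi>1 \<union> hUnion (hUnion \<sigma>1)) ((hUnion \<pi>1, p), (hUnion (hUnion \<sigma>1), r))"
    using compatible[of "hUnion \<pi>1" "hUnion (hUnion \<sigma>1)" "subasm a1 \<pi>1" "subasm a1 (hUnion \<sigma>1)" m2 q]
      s o fin\<sigma> q disj by (simp add: p_def r_def hUnion_Un subasm_Un)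
  moreover have "\<nu> (V1 \<union> hUnion \<pi>1 \<union> hUnion (hUnion \<sigma>1))
      ((V1 \<union> hUnion \<pi>1, \<nu> (V1 \<union> hUnion \<pi>1) ((V1, m1), (hUnion \<pi>1, p))), (hUnion (hUnion \<sigma>1), r)) =
      \<nu> (V1 \<union> hUnion \<pi>1 \<union> hUnion (hUnion \<sigma>1)) ((V1, m1), (hUnion \<pi>1 \<union> hUnion (hUnion \<sigma>1),
        \<nu> (hUnion \<pi>1 \<union> hUnion (hUnion \<sigma>1)) ((hUnion \<pi>1, p), (hUnion (hUnion \<sigma>1), r))))"
    using o p r fin\<sigma> disj by (intro monoid.assoc) auto
  moreover have "etabar \<eta> (subasm (etabar \<eta> (subasm a1 \<pi>2) a2) (flat ` \<sigma>2)) (mor (asm Op) \<sigma>2 flat a3) =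
      etabar \<eta> (subasm a1 (hUnion \<sigma>2)) (etabar \<eta> (subasm a2 \<sigma>2) a3)"
    unfolding restrict[OF \<sigma>2 U\<sigma>(2)]
    using module.etabar_assoc[of "hUnion (hUnion \<sigma>2)" "subasm a1 (hUnion \<sigma>2)" "subasm a2 \<sigma>2" a3]
      s t tD \<sigma> fin\<sigma> by simp
  ultimately show ?thesis
    by (simp add: rhobar_def sprod_def hUnion_flat hUnion_Un Un_assoc flip: p_def q_def)
qed

text \<open>The tags fix the splitting first; only then do both sides act by the same subassemblies,
  so that the cancellation laws become applicable.\<close>

lemma rhobar_cancel:
  assumes x2': "((\<pi>1', m2'), (\<pi>2', a2')) \<in> obj (sprod M (asm Op)) (Domain a1)"
    and eq: "rhobar \<nu> \<eta> \<tau> ((V1, m1), (V2, a1)) ((\<pi>1, m2), (\<pi>2, a2)) =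
      rhobar \<nu> \<eta> \<tau> ((V1, m1), (V2, a1)) ((\<pi>1', m2'), (\<pi>2', a2'))"
  shows "((\<pi>1, m2), (\<pi>2, a2)) = ((\<pi>1', m2'), (\<pi>2', a2'))"
proof -
  note o = rhobar_operands
  have o': "\<pi>1' \<union> \<pi>2' = Domain a1" "\<pi>1' \<inter> \<pi>2' = {}" "m2' \<in> obj M \<pi>1'" "a2' \<in> obj (asm Op) \<pi>2'"
    using x2' by (auto simp: sprod_iff)
  have sub: "\<pi>1 \<subseteq> Domain a1" "\<pi>2 \<subseteq> Domain a1" "\<pi>1' \<subseteq> Domain a1" "\<pi>2' \<subseteq> Domain a1"
    using o(6) o'(1) by auto
  have "hUnion \<pi>2 = hUnion \<pi>2'"
    using eq by (simp add: rhobar_def)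
  then have \<pi>2: "\<pi>2' = \<pi>2"
    using hUnion_cancel[OF o(2) asmD(1)[OF o(5)] sub(2,4)] by simp
  \<comment> \<open>Both are the complement of \<open>\<pi>2\<close> in
    \<open>Domain a1\<close>.\<close>
  then have \<pi>1: "\<pi>1' = \<pi>1"
    using o(6,7) o'(1,2) by blast
  note s = subasm_operand[OF sub(1)] subasm_operand[OF sub(2)]
  have disj: "V1 \<inter> hUnion \<pi>1 = {}"
    using o(3,13) by blast
  note U1 = finite_hUnion[OF o(10)]
  have m: "m2 \<in> obj M (Domain (subasm a1 \<pi>1))" "m2' \<in> obj M (Domain (subasm a1 \<pi>1))"
    using o(8) o'(3) s(2) \<pi>1 by simp_all
  have "\<nu> (V1 \<union> hUnion \<pi>1) ((V1, m1), (hUnion \<pi>1, \<tau> (hUnion \<pi>1) (subasm a1 \<pi>1, m2))) =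
      \<nu> (V1 \<union> hUnion \<pi>1) ((V1, m1), (hUnion \<pi>1, \<tau> (hUnion \<pi>1) (subasm a1 \<pi>1, m2')))"
    using eq \<pi>1 by (simp add: rhobar_def)
  then have "\<tau> (hUnion \<pi>1) (subasm a1 \<pi>1, m2) = \<tau> (hUnion \<pi>1) (subasm a1 \<pi>1, m2')"
    by (rule nu_cancel[OF o(1) U1 disj o(4) tau_in[OF U1 s(1) m(1)] tau_in[OF U1 s(1) m(2)]])
  then have "m2 = m2'"
    by (rule tau_cancel[OF U1 s(1) m])
  moreover have "etabar \<eta> (subasm a1 \<pi>2) a2 = etabar \<eta> (subasm a1 \<pi>2) a2'"
    using eq \<pi>2 by (simp add: rhobar_def)
  then have "a2 = a2'"
    using etabar_cancel[OF finite_hUnion[OF o(11)] s(3)] o(9) o'(4) s(4) \<pi>2 by simp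
  ultimately show ?thesis
    using \<pi>1 \<pi>2 by simp
qed

text \<open>The tag \<open>V1 \<union> hUnion \<pi>1\<close> of the monoid part must be empty. Hence
  all of \<open>a1\<close> goes to the operad side, where \<open>etabar_eq_idasm\<close>
  applies.\<close>

lemma rhobar_eq_unit:
  assumes eq: "rhobar \<nu> \<eta> \<tau> ((V1, m1), (V2, a1)) ((\<pi>1, m2), (\<pi>2, a2)) = (({}, \<ee>), (V, idasm e V))"
  shows "((V1, m1), (V2, a1)) = (({}, \<ee>), (V, idasm e V))"
    and "((\<pi>1, m2), (\<pi>2, a2)) = (({}, \<ee>), (Domain a1, idasm e (Domain a1)))"
proof -
  note o = rhobar_operands
  have V1: "V1 = {}" and U: "hUnion \<pi>1 = {}" and eta: "etabar \<eta> (subasm a1 \<pi>2) a2 = idasm e V"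
    using eq by (auto simp: rhobar_def)
  have V2: "V2 = V"
    using V1 x1 by (simp add: sprod_iff)
  \<comment> \<open>Blocks are nonempty, so only the empty set of blocks has empty union.\<close>
  have \<pi>1: "\<pi>1 = {}"
    using hUnion_cancel[OF o(2) asmD(1)[OF o(5)], of \<pi>1 "{}"] U o(6) by auto
  have \<pi>2: "\<pi>2 = Domain a1"
    using \<pi>1 o(6) by simp
  have "m1 = \<ee>" "m2 = \<ee>"
    using o(4,8) V1 \<pi>1 obj_M_empty by auto
  moreover have "a1 = idasm e V" "a2 = idasm e (Domain a1)"
    using etabar_eq_idasm[OF V] o(5,9) eta unfolding V2 \<pi>2 subasm_Domain by auto
  ultimately show "((V1, m1), (V2, a1)) = (({}, \<ee>), (V, idasm e V))"
    and "((\<pi>1, m2), (\<pi>2, a2)) = (({}, \<ee>), (Domain a1, idasm e (Domain a1)))"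
    using V1 V2 \<pi>1 \<pi>2 by auto
qed

end

end

theorem theorem7p1:
  fixes M :: "('a, 'm) species_data"
    and \<nu> :: "'a hset set \<Rightarrow> ('a hset set \<times> 'm) \<times> ('a hset set \<times> 'm) \<Rightarrow> 'm"
    and \<ee> :: 'm
    and Op :: "('a, 'o) species_data"
    and \<eta> :: "'a hset set \<Rightarrow> ('a hset \<times> 'o) set \<times> 'o \<Rightarrow> 'o"
    and e :: "'a hset \<Rightarrow> 'o"
    and \<tau> :: "'a hset set \<Rightarrow> ('a hset \<times> 'o) set \<times> 'm \<Rightarrow> 'm"
  assumes "c_monop M \<nu> \<ee> Op \<eta> e \<tau>"
    and "finite V"
    and "((V1, m1), (V2, a1)) \<in> obj (sprod M (asm Op)) V"
    and "((\<pi>1, m2), (\<pi>2, a2)) \<in> obj (sprod M (asm Op)) (Domain a1)"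
  shows
    "(\<forall>\<sigma>1 m3 \<sigma>2 a3. ((\<sigma>1, m3), (\<sigma>2, a3)) \<in> obj (sprod M (asm Op)) (Domain a2) \<longrightarrow>
        rhobar \<nu> \<eta> \<tau> (rhobar \<nu> \<eta> \<tau> ((V1, m1), (V2, a1)) ((\<pi>1, m2), (\<pi>2, a2)))
          (mor (sprod M (asm Op)) (Domain a2) flat ((\<sigma>1, m3), (\<sigma>2, a3))) =
        rhobar \<nu> \<eta> \<tau> ((V1, m1), (V2, a1))
          (rhobar \<nu> \<eta> \<tau> ((\<pi>1, m2), (\<pi>2, a2)) ((\<sigma>1, m3), (\<sigma>2, a3)))) \<and>
     (\<forall>\<pi>1' m2' \<pi>2' a2'. ((\<pi>1', m2'), (\<pi>2', a2')) \<in> obj (sprod M (asm Op)) (Domain a1) \<longrightarrow>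
        rhobar \<nu> \<eta> \<tau> ((V1, m1), (V2, a1)) ((\<pi>1, m2), (\<pi>2, a2)) =
        rhobar \<nu> \<eta> \<tau> ((V1, m1), (V2, a1)) ((\<pi>1', m2'), (\<pi>2', a2')) \<longrightarrow>
        ((\<pi>1, m2), (\<pi>2, a2)) = ((\<pi>1', m2'), (\<pi>2', a2'))) \<and>
     (rhobar \<nu> \<eta> \<tau> ((V1, m1), (V2, a1)) ((\<pi>1, m2), (\<pi>2, a2)) = (({}, \<ee>), (V, idasm e V)) \<longrightarrow>
        ((V1, m1), (V2, a1)) = (({}, \<ee>), (V, idasm e V)) \<and>
        ((\<pi>1, m2), (\<pi>2, a2)) = (({}, \<ee>), (Domain a1, idasm e (Domain a1))))"
proof -
  interpret c_monop M \<nu> \<ee> Op \<eta> e \<tau>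
    by fact
  show ?thesis
    using rhobar_assoc[OF assms(2-4)] rhobar_cancel[OF assms(2-4)] rhobar_eq_unit[OF assms(2-4)]
    by blast
qed

end
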